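(* Let $X$ be a real Hausdorff locally convex topological vector space, let $F$ be a convex, symmetric subset of $X$ with $0\in\operatorname{int}(F)$, and let $\Omega\subset X$ be proper (i.e., both $\Omega$ and $\Omega^c$ are nonempty), convex, and closed in $X$. Then $$\partial\Delta_{\Omega}^F(\bar x)=\partial\mu_{\Omega}^F(\bar x)\cap F^\circ\quad\text{for every }\bar x\in\operatorname{bd}(\Omega).$$
   Context: $\Omega^c=X\setminus\Omega$; $\operatorname{bd}(\Omega)$ is the topological boundary; $X^*$ is the topological dual of $X$, with pairing $\langle x^*,x\rangle=x^*(x)$; $F$ symmetric means $F=-F$. For nonempty $A\subset X$, the minimal time function is $\mathcal{T}_{A}^F(x):=\inf\{t>0\mid (x+tF)\cap A\neq\emptyset\}$. The signed minimal time function is $\Delta_{\Omega}^F(x):=\mathcal{T}_{\Omega}^F(x)$ if $x\notin\Omega$ and $\Delta_{\Omega}^F(x):=-\mathcal{T}_{\Omega^c}^F(x)$ if $x\in\Omega$. The function $\mu_{\Omega}^F:X\to(-\infty,\infty]$ is $\mu_{\Omega}^F(x):=\infty$ if $x\in\Omega^c$ and $\mu_{\Omega}^F(x):=-\mathcal{T}_{\Omega^c}^F(x)$ if $x\in\Omega$. The polar of $F$ is $F^\circ:=\{x^*\in X^*\mid\langle x^*,x\rangle\le 1\text{ for all }x\in F\}$. For a convex function $\varphi:X\to(-\infty,\infty]$ and $\bar x$ with $\varphi(\bar x)<\infty$, $\partial\varphi(\bar x):=\{x^*\in X^*\mid\langle x^*,x-\bar x\rangle\le\varphi(x)-\varphi(\bar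 x)\text{ for all }x\in X\}$ (both $\Delta_\Omega^F$ and $\mu_\Omega^F$ are convex under the stated assumptions). *)

theory Defs
  imports "HOL-Analysis.Analysis"
begin

class topological_real_vector = real_vector + topological_ab_group_add +
  assumes tendsto_scaleR_Pair:
    "LIM p (nhds c \<times>\<^sub>F nhds x). fst p *\<^sub>R snd p :> nhds (c *\<^sub>R x)"

text \<open>The constant \<open>convex\<close> cannot be used inside a class specification, so the axiom spells out its
  definition; \<open>locally_convex\<close> restates it.\<close>

class locally_convex_t2_space = topological_real_vector + t2_space +
  assumes locally_convex_raw:
    "open U \<Longrightarrow> 0 \<in> U \<Longrightarrow>
      \<exists>C V. (\<forall>x\<in>C. \<forall>y\<in>C. \<forall>u\<ge>0. \<forall>v\<ge>0. u + v = 1 \<longrightarrow> u *\<^sub>R x + v *\<^sub>R y \<in> C)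
        \<and> C \<subseteq> U \<and> open V \<and> 0 \<in> V \<and> V \<subseteq> C"

lemma locally_convex:
  fixes U :: "'a::locally_convex_t2_space set"
  assumes "open U" "0 \<in> U"
  shows "\<exists>C V. convex C \<and> C \<subseteq> U \<and> open V \<and> 0 \<in> V \<and> V \<subseteq> C"
  using locally_convex_raw[OF assms] unfolding convex_def .

instance real_normed_vector \<subseteq> locally_convex_t2_space
proof
  fix c :: real and x :: 'a
  show "LIM p (nhds c \<times>\<^sub>F nhds x). fst p *\<^sub>R snd p :> nhds (c *\<^sub>R x)"
    by (intro tendsto_scaleR filterlim_fst filterlim_snd)
next
  fix U :: "'a set"
  assume "open U" "0 \<in> U"
  then obtain e where "e > 0" "ball 0 e \<subseteq> U"
    by (meson open_contains_ball)
  then have "\<exists>C V. convex C \<and> C \<subseteq> U \<and> open V \<and> 0 \<in> V \<and> V \<subseteq> C"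
    by (metis centre_in_ball convex_ball open_ball order_refl)
  then show "\<exists>C V. (\<forall>x\<in>C. \<forall>y\<in>C. \<forall>u\<ge>0. \<forall>v\<ge>0. u + v = 1 \<longrightarrow> u *\<^sub>R x + v *\<^sub>R y \<in> C)
        \<and> C \<subseteq> U \<and> open V \<and> 0 \<in> V \<and> V \<subseteq> C"
    unfolding convex_def .
qed

definition topological_dual :: "('a::topological_real_vector \<Rightarrow> real) set" where
  "topological_dual = {f. linear f \<and> continuous_on UNIV f}"

text \<open>The infimum is taken in the extended reals, so it is \<open>\<infinity>\<close> when no \<open>t\<close> qualifies.\<close>

definition minimal_time :: "'a::real_vector set \<Rightarrow> 'a set \<Rightarrow> 'a \<Rightarrow> ereal" where
  "minimal_time F A x = Inf {ereal t | t. t > 0 \<and> ((\<lambda>f. x + t *\<^sub>R f) ` F) \<inter> A \<noteq> {}}"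

definition signed_minimal_time :: "'a::real_vector set \<Rightarrow> 'a set \<Rightarrow> 'a \<Rightarrow> ereal" where
  "signed_minimal_time F \<Omega> x =
     (if x \<in> \<Omega> then - minimal_time F (- \<Omega>) x else minimal_time F \<Omega> x)"

definition mu_time :: "'a::real_vector set \<Rightarrow> 'a set \<Rightarrow> 'a \<Rightarrow> ereal" where
  "mu_time F \<Omega> x = (if x \<in> \<Omega> then - minimal_time F (- \<Omega>) x else \<infinity>)"

definition polar :: "'a::topological_real_vector set \<Rightarrow> ('a \<Rightarrow> real) set" where
  "polar F = {f \<in> topological_dual. \<forall>x\<in>F. f x \<le> 1}"

text \<open>Only meaningful at points where \<open>\<phi>\<close> is finite: in \<open>ereal\<close>, \<open>\<infinity> - \<infinity> = \<infinity>\<close>.\<close>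

definition subdifferential ::
    "('a::topological_real_vector \<Rightarrow> ereal) \<Rightarrow> 'a \<Rightarrow> ('a \<Rightarrow> real) set" where
  "subdifferential \<phi> x0 =
     {f \<in> topological_dual. \<forall>x. ereal (f (x - x0)) \<le> \<phi> x - \<phi> x0}"

end

theory Submission
  imports Defs
begin

text \<open>Both functions vanish at \<open>x0\<close>, and the signed function is below \<open>\<mu>\<close>, so its subgradients are
  subgradients of \<open>\<mu>\<close>; testing them at \<open>x0 + v\<close> with \<open>v \<in> F\<close>, from where \<open>x0\<close> is reached in time
  \<open>1\<close> by symmetry, puts them in the polar. Conversely, if \<open>w = x + t v\<close> lies in \<open>\<Omega>\<close> with \<open>v \<in> F\<close>, then
  \<open>f (x - x0) = f (w - x0) + t f (- v) \<le> 0 + t\<close>, and the infimum over such \<open>t\<close> is the minimal time.\<close>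

text \<open>Joint continuity of scaling, restricted to the slice \<open>x \<mapsto> (c, x)\<close>.
  It serves to pull \<open>interior F\<close> back to an open set.\<close>

lemma continuous_on_scaleR_right:
  "continuous_on UNIV (\<lambda>x::'a::topological_real_vector. c *\<^sub>R x)"
proof -
  have "((\<lambda>x::'a. c *\<^sub>R x) \<longlongrightarrow> c *\<^sub>R a) (at a)" for a
  proof -
    have "LIM x at a. (c, x) :> nhds c \<times>\<^sub>F nhds a"
      by (intro filterlim_Pair tendsto_const tendsto_ident_at)
    from filterlim_compose[OF tendsto_scaleR_Pair this] show ?thesis by simp
  qed
  then show ?thesis by (simp add: continuous_on_def)
qed

lemma minimal_time_nonneg: "0 \<le> minimal_time F A x"
  unfolding minimal_time_def by (rule Inf_greatest) auto

lemma minimal_time_le: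
  assumes "t > 0" "v \<in> F" "x + t *\<^sub>R v \<in> A"
  shows "minimal_time F A x \<le> ereal t"
  unfolding minimal_time_def using assms by (intro Inf_lower) auto

lemma minimal_time_greatest:
  assumes "\<And>t v. t > 0 \<Longrightarrow> v \<in> F \<Longrightarrow> x + t *\<^sub>R v \<in> A \<Longrightarrow> c \<le> ereal t"
  shows "c \<le> minimal_time F A x"
  unfolding minimal_time_def using assms by (intro Inf_greatest) auto

text \<open>For each \<open>t > 0\<close> the set \<open>x + t F\<close> is a neighbourhood of
  \<open>x\<close>, so it meets \<open>A\<close>; the minimal time is thus below every positive
  \<open>t\<close>.\<close>

lemma minimal_time_eq_0_closure:
  fixes F A :: "'a::topological_real_vector set"
  assumes "0 \<in> interior F" "x \<in> closure A"
  shows "minimal_time F A x = 0"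
proof (rule antisym)
  show "minimal_time F A x \<le> 0"
  proof (rule ereal_le_epsilon2)
    fix t :: real assume "t > 0"
    \<comment> \<open>This is \<open>x + t (interior F)\<close>, written as a preimage so that
      openness follows from continuity.\<close>
    define U where "U = (\<lambda>y. (1 / t) *\<^sub>R (y - x)) -` interior F"
    have "continuous_on UNIV (\<lambda>y. (1 / t) *\<^sub>R (y - x))"
      by (rule continuous_on_compose2[OF continuous_on_scaleR_right])
        (auto intro!: continuous_intros)
    then have "open U" unfolding U_def by (intro open_vimage open_interior)
    moreover have "x \<in> U" using assms(1) by (simp add: U_def)
    ultimately have "U \<inter> A \<noteq> {}"
      using assms(2) open_Int_closure_eq_empty[of U A] by blast
    then obtain y where y: "y \<in> A" "y \<in> U" by blast
    have "x + t *\<^sub>R ((1 / t) *\<^sub>R (y - x)) = y" using \<open>t > 0\<close> by simp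
    moreover have "(1 / t) *\<^sub>R (y - x) \<in> F"
      using y(2) interior_subset by (auto simp only: U_def vimage_eq)
    ultimately have "minimal_time F A x \<le> ereal t"
      using \<open>t > 0\<close> y(1) by (metis minimal_time_le)
    then show "minimal_time F A x \<le> 0 + ereal t" by simp
  qed
qed (rule minimal_time_nonneg)

lemma signed_minimal_time_le_mu_time: "signed_minimal_time F \<Omega> x \<le> mu_time F \<Omega> x"
  by (simp add: signed_minimal_time_def mu_time_def)

theorem proposition5p8:
  fixes F \<Omega> :: "'a::locally_convex_t2_space set" and x0 :: 'a
  assumes "convex F"
    and "F = uminus ` F"
    and "0 \<in> interior F"
    and "\<Omega> \<noteq> {}"
    and "- \<Omega> \<noteq> {}"
    and "convex \<Omega>"
    and "closed \<Omega>"
    and "x0 \<in> frontier \<Omega>"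
  shows "subdifferential (signed_minimal_time F \<Omega>) x0
         = subdifferential (mu_time F \<Omega>) x0 \<inter> polar F"
proof -
  have x0: "x0 \<in> \<Omega>" "x0 \<in> closure (- \<Omega>)"
    using assms(7,8) by (auto simp: frontier_closures)
  have uminus_F: "- v \<in> F" if "v \<in> F" for v
    using imageI[OF that, of uminus] unfolding assms(2)[symmetric] .
  have "minimal_time F (- \<Omega>) x0 = 0"
    using assms(3) x0(2) by (rule minimal_time_eq_0_closure)
  \<comment> \<open>With value \<open>0\<close> at \<open>x0\<close>, the difference in
    \<open>subdifferential\<close> reduces to the function itself, and no
    \<open>\<infinity> - \<infinity>\<close> can occur.\<close>
  then have signed_0: "signed_minimal_time F \<Omega> x0 = 0" and mu_0: "mu_time F \<Omega> x0 = 0"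
    using x0(1) by (simp_all add: signed_minimal_time_def mu_time_def)
  show ?thesis
  proof (intro equalityI subsetI IntI)
    fix f assume "f \<in> subdifferential (signed_minimal_time F \<Omega>) x0"
    then have dual: "f \<in> topological_dual"
      and f: "\<And>x. ereal (f (x - x0)) \<le> signed_minimal_time F \<Omega> x"
      by (auto simp: subdifferential_def signed_0)
    show "f \<in> subdifferential (mu_time F \<Omega>) x0"
      using dual order_trans[OF f signed_minimal_time_le_mu_time]
      by (simp add: subdifferential_def mu_0)
    have "f v \<le> 1" if "v \<in> F" for v
    proof -
      have "minimal_time F \<Omega> (x0 + v) \<le> ereal 1"
        using uminus_F[OF that] x0(1) by (intro minimal_time_le[of 1 "- v"]) auto
      \<comment> \<open>The point \<open>x0 + v\<close> may lie in \<open>\<Omega>\<close>; there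
        the signed function is nonpositive.\<close>
      moreover have "- minimal_time F (- \<Omega>) (x0 + v) \<le> ereal 1"
        by (rule order_trans[of _ 0]) (simp_all add: minimal_time_nonneg)
      ultimately have "signed_minimal_time F \<Omega> (x0 + v) \<le> ereal 1"
        by (simp add: signed_minimal_time_def)
      with f[of "x0 + v"] have "ereal (f (x0 + v - x0)) \<le> ereal 1" by (rule order_trans)
      then show ?thesis by simp
    qed
    with dual show "f \<in> polar F" by (simp add: polar_def)
  next
    fix f assume "f \<in> subdifferential (mu_time F \<Omega>) x0 \<inter> polar F"
    then have dual: "f \<in> topological_dual"
      and f: "\<And>x. ereal (f (x - x0)) \<le> mu_time F \<Omega> x"
      and f_le_1: "\<And>v. v \<in> F \<Longrightarrow> f v \<le> 1"
      by (auto simp: subdifferential_def polar_def mu_0)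
    from dual have "linear f" by (simp add: topological_dual_def)
    \<comment> \<open>\<open>\<mu>\<close> is nonpositive on \<open>\<Omega>\<close>, so
      \<open>f\<close> is a normal to \<open>\<Omega>\<close> at \<open>x0\<close>.\<close>
    have f_le_0: "f (w - x0) \<le> 0" if "w \<in> \<Omega>" for w
    proof -
      have "ereal (f (w - x0)) \<le> - minimal_time F (- \<Omega>) w"
        using f[of w] that by (simp add: mu_time_def)
      also have "\<dots> \<le> 0" by (simp add: minimal_time_nonneg)
      finally show ?thesis by simp
    qed
    have "ereal (f (x - x0)) \<le> minimal_time F \<Omega> x" for x
    proof (rule minimal_time_greatest)
      fix t v assume t: "t > 0" and v: "v \<in> F" and w: "x + t *\<^sub>R v \<in> \<Omega>"
      \<comment> \<open>The step is written with \<open>- v\<close> because the polar bounds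
        \<open>f\<close> on \<open>F\<close> only from above; symmetry puts \<open>- v\<close> in
        \<open>F\<close>.\<close>
      have "x - x0 = (x + t *\<^sub>R v - x0) + t *\<^sub>R (- v)" by simp
      then have "f (x - x0) = f (x + t *\<^sub>R v - x0) + t * f (- v)"
        by (simp only: linear_add[OF \<open>linear f\<close>] linear_scale[OF \<open>linear f\<close>] real_scaleR_def)
      also have "\<dots> \<le> 0 + t * 1"
        using f_le_0[OF w] f_le_1[OF uminus_F[OF v]] t by (intro add_mono mult_left_mono) auto
      finally show "ereal (f (x - x0)) \<le> ereal t" by simp
    qed
    \<comment> \<open>On \<open>\<Omega>\<close> the signed function is \<open>\<mu>\<close>, so the
      assumption on \<open>f\<close> applies; off \<open>\<Omega>\<close> it is the minimal time
      just bounded.\<close>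
    then have "ereal (f (x - x0)) \<le> signed_minimal_time F \<Omega> x" for x
      using f[of x] by (simp add: mu_time_def signed_minimal_time_def split: if_splits)
    with dual show "f \<in> subdifferential (signed_minimal_time F \<Omega>) x0"
      by (simp add: subdifferential_def signed_0)
  qed
qed

end
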